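(* Let $\mathcal G=(\mathcal V,\mathcal E)$ be a weakly connected directed multigraph, $w^l\in\mathbb R^{\mathcal E}_{\ge 0}$ and $w^u\in\mathbb R^{\mathcal E}_{>0}$ link weight bounds, $c^l\in\mathbb R^{\mathcal E}_{<0}$ and $c^u\in\mathbb R^{\mathcal E}_{>0}$ link capacity bounds, $p_0\in\mathbb R^{\mathcal V}$ an initial supply-demand vector with $\mathbf 1^{\mathrm T}p_0=0$, and $w_0\in[w^l,w^u]$, $w_0>\mathbf 0$, initial link weights such that the initial flow $f_0=f(w_0,p_0)$ satisfies $c^l\le f_0\le c^u$. Then the margin of robustness satisfies $$\nu^*(\mathcal G)\le 2\,C_{\min}(\mathcal G^{\mathrm{fl}},c^{\mathrm{fl}}),$$ where $(\mathcal G^{\mathrm{fl}},c^{\mathrm{fl}})$ is the associated flow network. Moreover, if $\mathcal G$ is a tree (as an undirected graph) or $w^l=\mathbf 0$, then $\nu^*(\mathcal G)=2\,C_{\min}(\mathcal G^{\mathrm{fl}},c^{\mathrm{fl}})$. In particular, if $\mathcal G$ is a tree, then $$\nu^*(\mathcal G)=2\min_{i\in\mathcal E}\ \min\{f_{0,i}-c^l_i,\ c^u_i-f_{0,i}\}.$$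
   Context: Multigraphs are finite, parallel links are allowed, there are no self-loops; link $i$ goes from tail $\sigma(i)$ to head $\tau(i)$. The incidence matrix $A\in\{-1,0,1\}^{\mathcal V\times\mathcal E}$ has $A_{vi}=1$ if $v=\sigma(i)$, $-1$ if $v=\tau(i)$, $0$ otherwise. DC power flow: for weights $w$ and balanced $p$ (i.e. $\mathbf 1^{\mathrm T}p=0$), $f(w,p)$ denotes the flow $f\in\mathbb R^{\mathcal E}$ with $Af=p$ and $f=\mathrm{diag}(w)A^{\mathrm T}\phi$ for some $\phi\in\mathbb R^{\mathcal V}$; for $w>\mathbf 0$ it exists and is unique, namely $f(w,p)=WA^{\mathrm T}L^\dagger p$ with $W=\mathrm{diag}(w)$, $L=AWA^{\mathrm T}$, and $L^\dagger$ the Moore–Penrose pseudoinverse. If some weights are zero, a weight $w$ counts as feasible below only if such a flow exists. Margin of robustness: $$\nu^*(\mathcal G):=\min_{\delta\in\mathbb R^{\mathcal V}:\ \|\delta\|_1=1,\ \mathbf 1^{\mathrm T}\delta=0}\nu(\delta),\qquad \nu(\delta):=\max\{\mu\ge 0:\ \exists\, w\in[w^l,w^u]\text{ with } c^l\le f(w,p_0+\mu\delta)\le c^u\}$$ (min and max read as infimum and supremum if not attained). Associated flow network: $\mathcal G^{\mathrm{fl}}=(\mathcal V,\mathcal E^{\mathrm{fl}})$, where $\mathcal E^{\mathrm{fl}}$ consists of the links of $\mathcal E$ together with a reversed copy of each link of $\mathcal E$; the capacity of $i\in\mathcal E$ is $c^{\mathrm{fl}}_i:=c^u_i-f_{0,i}$,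 and the capacity of the reversed copy of $i$ is $-c^l_i+f_{0,i}$ (all capacities are $\ge 0$). For $\emptyset\subsetneq\mathcal V_c\subsetneq\mathcal V$, the cut capacity is $C(\mathcal V_c,c^{\mathrm{fl}})=\sum_{i\in\mathcal E^{\mathrm{fl}}:\ \sigma(i)\in\mathcal V_c,\ \tau(i)\notin\mathcal V_c}c^{\mathrm{fl}}_i$, and $C_{\min}(\mathcal G^{\mathrm{fl}},c^{\mathrm{fl}})=\min_{\emptyset\subsetneq\mathcal V_c\subsetneq\mathcal V}C(\mathcal V_c,c^{\mathrm{fl}})$. *)

theory Defs
  imports "HOL-Library.Extended_Real" "Graph_Theory.Graph_Theory"
begin

text \<open>
  Vectors indexed by nodes or links are functions on the whole node or link type; only their values
  on \<open>verts G\<close> or \<open>arcs G\<close> matter.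
\<close>

definition incidence :: "('a, 'b) pre_digraph \<Rightarrow> 'a \<Rightarrow> 'b \<Rightarrow> real" where
  "incidence G v i = (if v = tail G i then 1 else if v = head G i then -1 else 0)"

definition balanced :: "('a, 'b) pre_digraph \<Rightarrow> ('a \<Rightarrow> real) \<Rightarrow> bool" where
  "balanced G p \<longleftrightarrow> (\<Sum>v\<in>verts G. p v) = 0"

text \<open>
  \<open>is_dc_flow G w p f\<close> says that \<open>f(w, p)\<close> exists and equals \<open>f\<close>. A relation is used because the
  flow need not exist when some weights vanish; the lemma below shows that it is functional.
\<close>

definition is_dc_flow ::
  "('a, 'b) pre_digraph \<Rightarrow> ('b \<Rightarrow> real) \<Rightarrow> ('a \<Rightarrow> real) \<Rightarrow> ('b \<Rightarrow> real) \<Rightarrow> bool" where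
  "is_dc_flow G w p f \<longleftrightarrow>
     (\<forall>v\<in>verts G. (\<Sum>i\<in>arcs G. incidence G v i * f i) = p v) \<and>
     (\<exists>\<phi>. \<forall>i\<in>arcs G. f i = w i * (\<Sum>v\<in>verts G. incidence G v i * \<phi> v))"

lemma is_dc_flow_unique:
  assumes "fin_digraph G" and w: "\<And>i. i \<in> arcs G \<Longrightarrow> 0 \<le> w i"
    and f: "is_dc_flow G w p f" and g: "is_dc_flow G w p g" and i: "i \<in> arcs G"
  shows "f i = g i"
proof -
  interpret fin_digraph G by fact
  obtain a b where
    a: "\<And>i. i \<in> arcs G \<Longrightarrow> f i = w i * (\<Sum>v\<in>verts G. incidence G v i * a v)" and
    b: "\<And>i. i \<in> arcs G \<Longrightarrow> g i = w i * (\<Sum>v\<in>verts G. incidence G v i * b v)"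
    using f g unfolding is_dc_flow_def by metis
  define x where "x j = (\<Sum>v\<in>verts G. incidence G v j * (a v - b v))" for j
  have d: "f j - g j = w j * x j" if "j \<in> arcs G" for j
    using a[OF that] b[OF that] by (simp add: x_def algebra_simps sum_subtractf)
  have "(\<Sum>j\<in>arcs G. w j * (x j)\<^sup>2) = (\<Sum>j\<in>arcs G. (f j - g j) * x j)"
    by (intro sum.cong) (auto simp: d power2_eq_square)
  also have "\<dots> = (\<Sum>j\<in>arcs G. \<Sum>v\<in>verts G. (a v - b v) * (incidence G v j * (f j - g j)))"
    unfolding x_def sum_distrib_left by (intro sum.cong) (auto simp: algebra_simps)
  also have "\<dots> = (\<Sum>v\<in>verts G. (a v - b v) * (\<Sum>j\<in>arcs G. incidence G v j * (f j - g j)))"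
    unfolding sum_distrib_left by (rule sum.swap)
  also have "\<dots> = 0"
    using f g by (intro sum.neutral) (auto simp: is_dc_flow_def right_diff_distrib sum_subtractf)
  finally have "w i * (x i)\<^sup>2 = 0"
    using i w by (subst (asm) sum_nonneg_eq_0_iff) auto
  then show ?thesis using d[OF i] by auto
qed

definition l1_norm_on :: "'a set \<Rightarrow> ('a \<Rightarrow> real) \<Rightarrow> real" where
  "l1_norm_on V d = (\<Sum>v\<in>V. \<bar>d v\<bar>)"

text \<open>
  Infima and suprema are taken in the extended reals, so that they are defined in all cases: for a
  graph with a single node the infima below range over the empty set and equal \<open>\<infinity>\<close>.
\<close>

definition margin_dir ::
  "('a, 'b) pre_digraph \<Rightarrow> ('b \<Rightarrow> real) \<Rightarrow> ('b \<Rightarrow> real) \<Rightarrow> ('b \<Rightarrow> real) \<Rightarrow> ('b \<Rightarrow> real) \<Rightarrow>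
   ('a \<Rightarrow> real) \<Rightarrow> ('a \<Rightarrow> real) \<Rightarrow> ereal" where
  "margin_dir G wl wu cl cu p0 \<delta> =
     (SUP \<mu>\<in>{\<mu>::real. 0 \<le> \<mu> \<and>
        (\<exists>w f. (\<forall>i\<in>arcs G. wl i \<le> w i \<and> w i \<le> wu i) \<and>
               is_dc_flow G w (\<lambda>v. p0 v + \<mu> * \<delta> v) f \<and>
               (\<forall>i\<in>arcs G. cl i \<le> f i \<and> f i \<le> cu i))}. ereal \<mu>)"

definition margin_of_robustness ::
  "('a, 'b) pre_digraph \<Rightarrow> ('b \<Rightarrow> real) \<Rightarrow> ('b \<Rightarrow> real) \<Rightarrow> ('b \<Rightarrow> real) \<Rightarrow> ('b \<Rightarrow> real) \<Rightarrow>
   ('a \<Rightarrow> real) \<Rightarrow> ereal" where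
  "margin_of_robustness G wl wu cl cu p0 =
     (INF \<delta>\<in>{\<delta>. l1_norm_on (verts G) \<delta> = 1 \<and> balanced G \<delta>}. margin_dir G wl wu cl cu p0 \<delta>)"

text \<open>The link \<open>Inl i\<close> is the link \<open>i\<close> itself, \<open>Inr i\<close> its reversed copy.\<close>

definition flow_network :: "('a, 'b) pre_digraph \<Rightarrow> ('a, 'b + 'b) pre_digraph" where
  "flow_network G =
     \<lparr> verts = verts G, arcs = arcs G <+> arcs G,
       tail = case_sum (tail G) (head G), head = case_sum (head G) (tail G) \<rparr>"

definition flow_capacity ::
  "('b \<Rightarrow> real) \<Rightarrow> ('b \<Rightarrow> real) \<Rightarrow> ('b \<Rightarrow> real) \<Rightarrow> 'b + 'b \<Rightarrow> real" where
  "flow_capacity cl cu f0 = case_sum (\<lambda>i. cu i - f0 i) (\<lambda>i. - cl i + f0 i)"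

definition cut_capacity :: "('a, 'b) pre_digraph \<Rightarrow> ('b \<Rightarrow> real) \<Rightarrow> 'a set \<Rightarrow> real" where
  "cut_capacity G c U = (\<Sum>i\<in>{i \<in> arcs G. tail G i \<in> U \<and> head G i \<notin> U}. c i)"

definition min_cut_capacity :: "('a, 'b) pre_digraph \<Rightarrow> ('b \<Rightarrow> real) \<Rightarrow> ereal" where
  "min_cut_capacity G c = (INF U\<in>{U. {} \<subset> U \<and> U \<subset> verts G}. ereal (cut_capacity G c U))"

text \<open>
  The library predicate \<^const>\<open>tree\<close> only excludes directed cycles, so it does not express being a
  tree as an undirected graph. A cycle of the underlying undirected multigraph is a cycle that may
  traverse links in both directions but uses every link at most once; two parallel links form one.
\<close>

definition undirected_cycle :: "('a, 'b) pre_digraph \<Rightarrow> ('b + 'b) list \<Rightarrow> bool" where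
  "undirected_cycle G p \<longleftrightarrow>
     pre_digraph.cycle (flow_network G) p \<and> distinct (map (case_sum id id) p)"

definition undirected_tree :: "('a, 'b) pre_digraph \<Rightarrow> bool" where
  "undirected_tree G \<longleftrightarrow> Digraph_Component.connected G \<and> (\<nexists>p. undirected_cycle G p)"

end

theory Submission
  imports Defs
begin

text \<open>
  Fix an admissible direction \<open>\<delta>\<close>. Everything rests on comparing a flow \<open>f\<close> for the perturbed demand
  \<open>p0 + \<mu> \<delta>\<close> with the initial flow \<open>f0\<close>: within the bounds \<open>cl\<close> and \<open>cu\<close>, the difference
  \<open>f - f0\<close> is a flow with divergence \<open>\<mu> \<delta>\<close> that respects the capacities of the associated flow
  network.

  Upper bound. Summed over a node set \<open>U\<close>, the divergence of \<open>f - f0\<close> is the net flow out of \<open>U\<close>,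
  hence at most the capacity of the cut. If \<open>\<delta>\<close> moves half a unit from a node inside \<open>U\<close> to a node
  outside, this reads \<open>\<mu> / 2 \<le> C(U)\<close> (\<open>margin_le_cut\<close>).

  Equality. Since \<open>\<delta>\<close> is balanced and has norm 1, its sum over any set is at most \<open>1/2\<close>, so for
  \<open>\<mu> = 2 Cmin\<close> no cut obstructs a flow with divergence \<open>\<mu> \<delta>\<close>. Gale's supply-demand theorem
  (\<open>gale_supply_demand\<close>) then supplies a flow \<open>f\<close> within the bounds. It remains to make \<open>f\<close> a DC flow.

  \<^item> In a tree, removing a link separates its two ends. The resulting cuts show that every vector of
    link values is a vector of potential differences (\<open>forest_potential_exists\<close>), so every flow is a
    DC flow for any positive weights, in particular for the initial ones.
  \<^item> If the lower weight bounds vanish, cancelling flow along directed cycles leads to a flow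
    with the same divergence that is nowhere farther from zero or reversed, hence still within the bounds
    \<open>cl < 0 < cu\<close>, and whose direction is acyclic (\<open>cancel_cycles\<close>). A potential that decreases
    steeply along the flow makes the quotients of flow and potential difference as small as required
    (\<open>acyclic_flow_realisable\<close>).

  In a tree, the cut that separates the ends of a link is crossed by this link only, and every cut of
  a connected graph is crossed by some link; this turns the minimum over cuts into one over links.
\<close>

section \<open>Divergence and potential differences\<close>

abbreviation divergence :: "('a, 'b) pre_digraph \<Rightarrow> ('b \<Rightarrow> real) \<Rightarrow> 'a \<Rightarrow> real" where
  "divergence G f v \<equiv> (\<Sum>i\<in>arcs G. incidence G v i * f i)"

locale loopfree_multigraph = fin_digraph G + loopfree_digraph G for G :: "('a, 'b) pre_digraph"
begin

lemma incidence_eq: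
  assumes "i \<in> arcs G"
  shows "incidence G v i = of_bool (v = tail G i) - of_bool (v = head G i)"
  using no_loops[OF assms] by (auto simp: incidence_def)

lemma sum_incidence:
  assumes "i \<in> arcs G" and "U \<subseteq> verts G"
  shows "(\<Sum>v\<in>U. incidence G v i * x v)
           = of_bool (tail G i \<in> U) * x (tail G i) - of_bool (head G i \<in> U) * x (head G i)"
proof -
  have "finite U" using assms(2) finite_verts by (rule finite_subset)
  have "(\<Sum>v\<in>U. of_bool (v = a) * x v) = of_bool (a \<in> U) * x a" for a
    using \<open>finite U\<close> by (simp add: of_bool_def if_distrib[of "\<lambda>c. c * _"] cong: if_cong)
  then show ?thesis
    using assms by (simp add: incidence_eq left_diff_distrib sum_subtractf)
qed

lemma potential_difference:
  assumes "i \<in> arcs G"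
  shows "(\<Sum>v\<in>verts G. incidence G v i * \<phi> v) = \<phi> (tail G i) - \<phi> (head G i)"
  using assms by (simp add: sum_incidence)

lemma sum_divergence:
  assumes "U \<subseteq> verts G"
  shows "(\<Sum>v\<in>U. divergence G f v)
           = (\<Sum>i\<in>arcs G. (of_bool (tail G i \<in> U) - of_bool (head G i \<in> U)) * f i)"
proof -
  have "(\<Sum>v\<in>U. divergence G f v) = (\<Sum>i\<in>arcs G. (\<Sum>v\<in>U. incidence G v i * 1) * f i)"
    by (subst sum.swap) (simp add: sum_distrib_right)
  also have "\<dots> = (\<Sum>i\<in>arcs G. (of_bool (tail G i \<in> U) - of_bool (head G i \<in> U)) * f i)"
    using assms by (intro sum.cong refl) (subst sum_incidence, simp_all)
  finally show ?thesis .
qed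

end

section \<open>Flows with prescribed divergence\<close>

text \<open>
  The capacity of the cut \<open>U\<close> when link \<open>i\<close> may carry any flow between \<open>- r i\<close> and \<open>s i\<close>: links
  that leave \<open>U\<close> contribute \<open>s\<close>, links that enter it contribute \<open>r\<close>.
\<close>

definition cut_bound ::
  "'b set \<Rightarrow> ('b \<Rightarrow> 'a) \<Rightarrow> ('b \<Rightarrow> 'a) \<Rightarrow> ('b \<Rightarrow> real) \<Rightarrow> ('b \<Rightarrow> real) \<Rightarrow> 'a set \<Rightarrow> real" where
  "cut_bound E t h s r U =
     (\<Sum>i\<in>E. if t i \<in> U \<and> h i \<notin> U then s i else if h i \<in> U \<and> t i \<notin> U then r i else 0)"

text \<open>
  The inequality holds link by link: the two sides differ only at links between \<open>U - W\<close> and \<open>W - U\<close>,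
  which cross \<open>U\<close> and \<open>W\<close> but neither the intersection nor the union.
\<close>

lemma cut_bound_submodular:
  assumes "\<And>i. i \<in> E \<Longrightarrow> 0 \<le> s i" and "\<And>i. i \<in> E \<Longrightarrow> 0 \<le> r i"
  shows "cut_bound E t h s r (U \<inter> W) + cut_bound E t h s r (U \<union> W)
           \<le> cut_bound E t h s r U + cut_bound E t h s r W"
  unfolding cut_bound_def sum.distrib[symmetric] using assms by (intro sum_mono) auto

text \<open>
  Gale's theorem: the cut conditions suffice for a flow with prescribed divergence. By induction on the
  links, it is enough to choose the flow \<open>x\<close> on one link \<open>a\<close> such that the remaining links satisfy the
  cut conditions for the remaining demand. A cut that \<open>a\<close> leaves bounds \<open>x\<close> from below, a cut that \<open>a\<close>
  enters bounds it from above, and submodularity shows that these bounds are compatible with each other.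
\<close>

lemma gale_supply_demand:
  fixes d :: "'a \<Rightarrow> real" and s r :: "'b \<Rightarrow> real"
  assumes "finite E" and "finite V" and "\<And>i. i \<in> E \<Longrightarrow> t i \<in> V \<and> h i \<in> V"
    and "\<And>i. i \<in> E \<Longrightarrow> 0 \<le> s i" and "\<And>i. i \<in> E \<Longrightarrow> 0 \<le> r i"
    and "sum d V = 0" and "\<And>U. U \<subseteq> V \<Longrightarrow> sum d U \<le> cut_bound E t h s r U"
  shows "\<exists>g. (\<forall>i\<in>E. - r i \<le> g i \<and> g i \<le> s i) \<and>
             (\<forall>v\<in>V. (\<Sum>i\<in>E. (of_bool (v = t i) - of_bool (v = h i)) * g i) = d v)"
  using assms
proof (induction E arbitrary: d)
  case empty
  have "d v = 0" if "v \<in> V" for v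
  proof -
    have "d v \<le> 0" using empty(6)[of "{v}"] that by (simp add: cut_bound_def)
    moreover have "sum d (V - {v}) \<le> 0" using empty(6)[of "V - {v}"] by (simp add: cut_bound_def)
    moreover have "d v + sum d (V - {v}) = 0"
      using sum.remove[OF \<open>finite V\<close> that, of d] \<open>sum d V = 0\<close> by simp
    ultimately show ?thesis by linarith
  qed
  then show ?case by simp
next
  case (insert a E)
  define k where "k = cut_bound E t h s r"
  have fin: "finite U" if "U \<subseteq> V" for U using that \<open>finite V\<close> finite_subset by auto
  have k_insert: "cut_bound (insert a E) t h s r U =
      k U + (if t a \<in> U \<and> h a \<notin> U then s a else if h a \<in> U \<and> t a \<notin> U then r a else 0)" for U
    using insert.hyps by (simp add: k_def cut_bound_def)
  define Outs where "Outs = {U. U \<subseteq> V \<and> t a \<in> U \<and> h a \<notin> U}"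
  define Ins where "Ins = {U. U \<subseteq> V \<and> h a \<in> U \<and> t a \<notin> U}"
  define L where "L = insert (- r a) ((\<lambda>U. sum d U - k U) ` Outs)"
  define R where "R = insert (s a) ((\<lambda>U. k U - sum d U) ` Ins)"
  have "finite Outs" "finite Ins" using \<open>finite V\<close> by (auto simp: Outs_def Ins_def)
  then have "finite L" "L \<noteq> {}" by (auto simp: L_def)
  have bound: "sum d U \<le> cut_bound (insert a E) t h s r U" if "U \<subseteq> V" for U
    using insert.prems(6) that by blast
  have out: "sum d U \<le> k U + s a" if "U \<in> Outs" for U
    using bound[of U] that by (auto simp: Outs_def k_insert)
  have inn: "sum d U \<le> k U + r a" if "U \<in> Ins" for U
    using bound[of U] that by (auto simp: Ins_def k_insert)
  \<comment> \<open>The link \<open>a\<close> crosses \<open>U\<close> and \<open>W\<close> in opposite directions, so it crosses neither their intersection nor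
    their union, and there the cut condition only involves the remaining links.\<close>
  have cross: "sum d U - k U \<le> k W - sum d W" if U: "U \<in> Outs" and W: "W \<in> Ins" for U W
  proof -
    have sub: "U \<subseteq> V" "W \<subseteq> V" using U W by (auto simp: Outs_def Ins_def)
    have "sum d (U \<inter> W) \<le> k (U \<inter> W)"
      using bound[of "U \<inter> W"] U W by (auto simp: Outs_def Ins_def k_insert)
    moreover have "sum d (U \<union> W) \<le> k (U \<union> W)"
      using bound[of "U \<union> W"] U W by (auto simp: Outs_def Ins_def k_insert)
    moreover have "k (U \<inter> W) + k (U \<union> W) \<le> k U + k W"
      unfolding k_def using insert.prems by (intro cut_bound_submodular) auto
    moreover have "sum d (U \<union> W) + sum d (U \<inter> W) = sum d U + sum d W"
      using sub fin by (intro sum.union_inter) auto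
    ultimately show ?thesis by linarith
  qed
  have LR: "l \<le> u" if "l \<in> L" "u \<in> R" for l u
  proof -
    have "0 \<le> s a" "0 \<le> r a" using insert.prems(3,4) by auto
    consider "l = - r a" | U where "U \<in> Outs" "l = sum d U - k U" using \<open>l \<in> L\<close> by (auto simp: L_def)
    then show ?thesis
    proof cases
      case 1
      consider "u = s a" | W where "W \<in> Ins" "u = k W - sum d W" using \<open>u \<in> R\<close> by (auto simp: R_def)
      then show ?thesis using 1 inn \<open>0 \<le> s a\<close> \<open>0 \<le> r a\<close> by cases force+
    next
      case 2
      consider "u = s a" | W where "W \<in> Ins" "u = k W - sum d W" using \<open>u \<in> R\<close> by (auto simp: R_def)
      then show ?thesis
      proof cases
        case 1
        then show ?thesis using 2 out[of U] by simp
      next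
        case W: 2
        then show ?thesis using 2 cross[of U W] by simp
      qed
    qed
  qed
  \<comment> \<open>Any value between the lower bounds \<open>L\<close> and the upper bounds \<open>R\<close> is a possible flow on \<open>a\<close>.\<close>
  define x where "x = Max L"
  have L_le: "l \<le> x" if "l \<in> L" for l
    unfolding x_def using \<open>finite L\<close> that by simp
  have le_R: "x \<le> u" if "u \<in> R" for u
    unfolding x_def using \<open>finite L\<close> \<open>L \<noteq> {}\<close> LR that by simp
  define d' where "d' v = d v - (of_bool (v = t a) - of_bool (v = h a)) * x" for v
  have sum_d': "sum d' U = sum d U - (of_bool (t a \<in> U) - of_bool (h a \<in> U)) * x"
    if "U \<subseteq> V" for U
  proof -
    have "(\<Sum>v\<in>U. of_bool (v = b) * x) = of_bool (b \<in> U) * x" for b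
      using fin[OF that] by (simp add: of_bool_def if_distrib[of "\<lambda>c. c * _"] cong: if_cong)
    then show ?thesis by (simp add: d'_def sum_subtractf left_diff_distrib)
  qed
  have "sum d' V = 0"
    using insert.prems(2)[of a] \<open>sum d V = 0\<close> by (simp add: sum_d')
  moreover have "sum d' U \<le> k U" if U: "U \<subseteq> V" for U
  proof -
    consider "U \<in> Outs" | "U \<in> Ins" | "t a \<in> U \<longleftrightarrow> h a \<in> U"
      using U unfolding Outs_def Ins_def by blast
    then show ?thesis
    proof cases
      case 1
      then show ?thesis
        using L_le[of "sum d U - k U"] sum_d'[OF U] by (auto simp: L_def Outs_def)
    next
      case 2
      then show ?thesis
        using le_R[of "k U - sum d U"] sum_d'[OF U] by (auto simp: R_def Ins_def)
    next
      case 3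
      then show ?thesis using bound[OF U] sum_d'[OF U] by (auto simp: k_insert)
    qed
  qed
  ultimately have "\<exists>g. (\<forall>i\<in>E. - r i \<le> g i \<and> g i \<le> s i) \<and>
      (\<forall>v\<in>V. (\<Sum>i\<in>E. (of_bool (v = t i) - of_bool (v = h i)) * g i) = d' v)"
    using insert.prems(1-4) unfolding k_def by (intro insert.IH) simp_all
  then obtain g where g: "\<And>i. i \<in> E \<Longrightarrow> - r i \<le> g i \<and> g i \<le> s i"
    "\<And>v. v \<in> V \<Longrightarrow> (\<Sum>i\<in>E. (of_bool (v = t i) - of_bool (v = h i)) * g i) = d' v"
    by blast
  have "(\<Sum>i\<in>insert a E. (of_bool (v = t i) - of_bool (v = h i)) * (g(a := x)) i) = d v"
    if "v \<in> V" for v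
  proof -
    have "(\<Sum>i\<in>E. (of_bool (v = t i) - of_bool (v = h i)) * (g(a := x)) i) = d' v"
      unfolding g(2)[OF that, symmetric] using insert.hyps by (intro sum.cong) auto
    then show ?thesis using insert.hyps by (simp add: d'_def)
  qed
  moreover have "- r a \<le> x" "x \<le> s a"
    using L_le le_R by (auto simp: L_def R_def)
  ultimately show ?case
    using g(1) by (intro exI[of _ "g(a := x)"]) auto
qed

section \<open>Cuts of the associated flow network\<close>

lemma cut_capacity_flow_network:
  assumes "finite (arcs G)"
  shows "cut_capacity (flow_network G) (flow_capacity cl cu f0) U =
           cut_bound (arcs G) (tail G) (head G) (\<lambda>i. cu i - f0 i) (\<lambda>i. f0 i - cl i) U"
proof -
  let ?N = "flow_network G" and ?c = "flow_capacity cl cu f0"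
  have "cut_capacity ?N ?c U =
      (\<Sum>e\<in>arcs G <+> arcs G. if tail ?N e \<in> U \<and> head ?N e \<notin> U then ?c e else 0)"
    unfolding cut_capacity_def using assms
    by (subst sum.inter_filter) (auto simp: flow_network_def)
  also have "\<dots> = (\<Sum>i\<in>arcs G. if tail G i \<in> U \<and> head G i \<notin> U then cu i - f0 i else 0)
      + (\<Sum>i\<in>arcs G. if head G i \<in> U \<and> tail G i \<notin> U then f0 i - cl i else 0)"
    using assms
    by (simp add: sum.Plus flow_network_def flow_capacity_def comp_def cong: if_cong)
  also have "\<dots> = cut_bound (arcs G) (tail G) (head G) (\<lambda>i. cu i - f0 i) (\<lambda>i. f0 i - cl i) U"
    unfolding cut_bound_def sum.distrib[symmetric] by (intro sum.cong) auto
  finally show ?thesis .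
qed

text \<open>
  Without a crossing link, a walk in the underlying undirected graph could never leave \<open>U\<close>.
\<close>

lemma connected_cut_nonempty:
  assumes "Digraph_Component.connected G" and "{} \<subset> U" and "U \<subset> verts G"
  shows "\<exists>i\<in>arcs G. (tail G i \<in> U) \<noteq> (head G i \<in> U)"
proof (rule ccontr)
  assume none: "\<not> ?thesis"
  obtain u v where u: "u \<in> U" "u \<in> verts G" and v: "v \<in> verts G" "v \<notin> U"
    using assms by blast
  let ?S = "with_proj (mk_symmetric G)"
  have "u \<rightarrow>\<^sup>*\<^bsub>?S\<^esub> v"
    using assms(1) u v by (auto simp: connected_def strongly_connected_def)
  then have "(u, v) \<in> rtrancl_on (verts G) (arcs_ends ?S)"
    by (simp add: reachable_def)
  then have "v \<in> U"
  proof (induction rule: rtrancl_on_induct)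
    case (step y z)
    then have "(y, z) \<in> (\<Union>e\<in>arcs G. {(tail G e, head G e), (head G e, tail G e)})"
      by (simp add: parcs_mk_symmetric)
    then show ?case using none \<open>y \<in> U\<close> by auto
  qed (use u in auto)
  with v show False by simp
qed

text \<open>
  Since \<open>\<delta>\<close> sums to zero, its sums over \<open>U\<close> and over the complement are opposite, and their difference
  is bounded by the norm.
\<close>

lemma twice_sum_le_l1_norm:
  assumes "finite V" and "U \<subseteq> V" and "sum \<delta> V = 0"
  shows "2 * sum \<delta> U \<le> l1_norm_on V \<delta>"
proof -
  have "sum \<delta> (V - U) = - sum \<delta> U"
    using assms by (simp add: sum_diff)
  then have "2 * sum \<delta> U = sum \<delta> U - sum \<delta> (V - U)" by simp
  also have "\<dots> \<le> (\<Sum>v\<in>U. \<bar>\<delta> v\<bar>) + (\<Sum>v\<in>V - U. \<bar>\<delta> v\<bar>)"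
    unfolding diff_conv_add_uminus sum_negf[symmetric]
    by (intro add_mono sum_mono) (rule abs_ge_self abs_ge_minus_self)+
  also have "\<dots> = l1_norm_on V \<delta>"
    unfolding l1_norm_on_def using sum.subset_diff[OF assms(2,1), of "\<lambda>v. \<bar>\<delta> v\<bar>"] by simp
  finally show ?thesis .
qed

section \<open>Realising a flow by link weights\<close>

text \<open>
  The links of the flow network along which \<open>f\<close> runs: a link with negative flow is represented by its
  reversed copy.
\<close>

definition support_network :: "('a, 'b) pre_digraph \<Rightarrow> ('b \<Rightarrow> real) \<Rightarrow> ('a, 'b + 'b) pre_digraph" where
  "support_network G f =
     (flow_network G)\<lparr>arcs := {Inl i | i. i \<in> arcs G \<and> 0 < f i} \<union> {Inr i | i. i \<in> arcs G \<and> f i < 0}\<rparr>"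

context loopfree_multigraph
begin

lemma fin_digraph_flow_network: "fin_digraph (flow_network G)"
  by unfold_locales (auto simp: flow_network_def)

lemma fin_digraph_support_network: "fin_digraph (support_network G f)"
proof -
  have "{Inl i | i. i \<in> arcs G \<and> 0 < f i} \<union> {Inr i | i. i \<in> arcs G \<and> f i < 0} \<subseteq> arcs G <+> arcs G"
    by auto
  then have "finite (arcs (support_network G f))"
    unfolding support_network_def using finite_subset by fastforce
  then show ?thesis
    by unfold_locales (auto simp: support_network_def flow_network_def)
qed

text \<open>
  Unit flow along a walk has divergence 1 at the start and -1 at the end, hence divergence 0 if the walk
  is closed.
\<close>

lemma divergence_walk:
  fixes v :: 'a
  defines "inc \<equiv> case_sum (incidence G v) (\<lambda>i. - incidence G v i)"
  assumes "pre_digraph.cas (flow_network G) u p w" and "set p \<subseteq> arcs G <+> arcs G"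
  shows "sum_list (map inc p) = of_bool (v = u) - of_bool (v = w)"
  using assms(2,3)
proof (induction p arbitrary: u)
  case Nil
  then show ?case by (simp add: pre_digraph.cas.simps)
next
  case (Cons e p)
  then show ?case
    by (cases e) (auto simp: pre_digraph.cas.simps inc_def incidence_eq flow_network_def)
qed

text \<open>
  Subtracting from the flow its smallest absolute value along a directed cycle brings one link of the
  cycle to zero and reverses none.
\<close>

lemma cancel_one_cycle:
  assumes "\<not> acyclic (arcs_ends (support_network G f))"
  shows "\<exists>f'. (\<forall>i\<in>arcs G. min 0 (f i) \<le> f' i \<and> f' i \<le> max 0 (f i)) \<and>
              divergence G f' = divergence G f \<and>
              {i \<in> arcs G. f' i \<noteq> 0} \<subset> {i \<in> arcs G. f i \<noteq> 0}"
proof -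
  let ?H = "support_network G f"
  interpret H: fin_digraph ?H by (rule fin_digraph_support_network)
  obtain u where "u \<rightarrow>\<^sup>+\<^bsub>?H\<^esub> u" using assms by (auto simp: acyclic_def)
  then obtain q where "H.closed_w q" unfolding H.reachable1_awalk H.closed_w_def by auto
  then obtain p u where p: "H.awalk u p u" "distinct p" "p \<noteq> []"
    using H.closed_w_imp_cycle unfolding H.cycle_conv by blast
  \<comment> \<open>Walks depend on the ends of links only, and these agree in both networks.\<close>
  have cas: "pre_digraph.cas (flow_network G) u p u"
  proof -
    have "pre_digraph.cas (flow_network G) u p w = H.cas u p w" for u p w
      by (induction p arbitrary: u) (auto simp: pre_digraph.cas.simps support_network_def)
    then show ?thesis using p by (simp add: H.awalk_def)
  qed
  have p_arcs: "set p \<subseteq> arcs ?H" using p by (simp add: H.awalk_def)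
  then have p_sub: "set p \<subseteq> arcs G <+> arcs G" by (auto simp: support_network_def)
  define link :: "'b + 'b \<Rightarrow> 'b" where "link = case_sum id id"
  define \<epsilon> where "\<epsilon> = Min ((\<lambda>e. \<bar>f (link e)\<bar>) ` set p)"
  have \<epsilon>_le: "\<epsilon> \<le> \<bar>f (link e)\<bar>" if "e \<in> set p" for e
    unfolding \<epsilon>_def using that by simp
  have "\<epsilon> \<in> (\<lambda>e. \<bar>f (link e)\<bar>) ` set p"
    unfolding \<epsilon>_def using p by (intro Min_in) auto
  then obtain e where e: "e \<in> set p" "\<epsilon> = \<bar>f (link e)\<bar>" by auto
  \<comment> \<open>The unit flow around the cycle, as a flow on the original links.\<close>
  define \<chi> :: "'b \<Rightarrow> real" where "\<chi> i = of_bool (Inl i \<in> set p) - of_bool (Inr i \<in> set p)" for i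
  have \<chi>: "divergence G \<chi> v = 0" for v
  proof -
    let ?inc = "case_sum (incidence G v) (\<lambda>i. - incidence G v i)"
    have "0 = sum_list (map ?inc p)"
      using divergence_walk[OF cas p_sub] by simp
    also have "\<dots> = sum ?inc (set p)"
      using p by (simp add: sum_list_distinct_conv_sum_set)
    also have "\<dots> = (\<Sum>e\<in>arcs G <+> arcs G. if e \<in> set p then ?inc e else 0)"
      using p_sub by (simp add: sum.inter_restrict[symmetric] Int_absorb1)
    also have "\<dots> = divergence G \<chi> v"
      by (simp add: sum.Plus sum.distrib[symmetric]) (auto intro!: sum.cong simp: \<chi>_def)
    finally show ?thesis by simp
  qed
  define f' where "f' i = f i - \<epsilon> * \<chi> i" for i
  have signs: "(Inl i \<in> set p \<longrightarrow> 0 < f i) \<and> (Inr i \<in> set p \<longrightarrow> f i < 0)" for i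
    using p_arcs by (auto simp: support_network_def)
  have pos: "0 < f i" "Inr i \<notin> set p" "\<epsilon> \<le> f i" "\<chi> i = 1" if "Inl i \<in> set p" for i
    using that signs[of i] \<epsilon>_le[OF that] by (auto simp: link_def \<chi>_def)
  have neg: "f i < 0" "Inl i \<notin> set p" "\<epsilon> \<le> - f i" "\<chi> i = -1" if "Inr i \<in> set p" for i
    using that signs[of i] \<epsilon>_le[OF that] by (auto simp: link_def \<chi>_def)
  have zero: "\<chi> i = 0" if "Inl i \<notin> set p" "Inr i \<notin> set p" for i
    using that by (simp add: \<chi>_def)
  have "0 \<le> \<epsilon>" using e by simp
  have between: "min 0 (f i) \<le> f' i \<and> f' i \<le> max 0 (f i)" for i
  proof -
    consider "Inl i \<in> set p" | "Inr i \<in> set p" | "Inl i \<notin> set p" "Inr i \<notin> set p" by blast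
    then show ?thesis
    proof cases
      case 1
      then show ?thesis using pos[OF 1] \<open>0 \<le> \<epsilon>\<close> by (simp add: f'_def)
    next
      case 2
      then show ?thesis using neg[OF 2] \<open>0 \<le> \<epsilon>\<close> by (simp add: f'_def)
    next
      case 3
      then show ?thesis using zero by (simp add: f'_def)
    qed
  qed
  have div: "divergence G f' = divergence G f"
  proof
    fix v
    have "divergence G f' v = divergence G f v - \<epsilon> * divergence G \<chi> v"
      by (simp add: f'_def right_diff_distrib sum_subtractf sum_distrib_left mult.left_commute)
    then show "divergence G f' v = divergence G f v" using \<chi> by simp
  qed
  have e_link: "f' (link e) = 0" "f (link e) \<noteq> 0" "link e \<in> arcs G"
  proof -
    have "f' (link e) = 0 \<and> f (link e) \<noteq> 0 \<and> link e \<in> arcs G"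
    proof (cases e)
      case (Inl i)
      then show ?thesis using e p_sub pos[of i] by (auto simp: f'_def link_def)
    next
      case (Inr i)
      then show ?thesis using e p_sub neg[of i] by (auto simp: f'_def link_def)
    qed
    then show "f' (link e) = 0" "f (link e) \<noteq> 0" "link e \<in> arcs G" by blast+
  qed
  have sub: "{i \<in> arcs G. f' i \<noteq> 0} \<subset> {i \<in> arcs G. f i \<noteq> 0}"
  proof
    have "f' i = 0" if "f i = 0" for i using between[of i] that by simp
    then show "{i \<in> arcs G. f' i \<noteq> 0} \<subseteq> {i \<in> arcs G. f i \<noteq> 0}" by blast
    show "{i \<in> arcs G. f' i \<noteq> 0} \<noteq> {i \<in> arcs G. f i \<noteq> 0}" using e_link by blast
  qed
  show ?thesis by (intro exI[of _ f'] conjI ballI between[THEN conjunct1] between[THEN conjunct2] div sub)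
qed

text \<open>
  Cancelling a cycle shrinks the support, so the process ends with an acyclic direction of flow. The flow
  on each link moves towards zero without changing sign, hence it keeps all bounds of the form
  \<open>cl \<le> f \<le> cu\<close> with \<open>cl \<le> 0 \<le> cu\<close>.
\<close>

lemma cancel_cycles:
  "\<exists>f'. (\<forall>i\<in>arcs G. min 0 (f i) \<le> f' i \<and> f' i \<le> max 0 (f i)) \<and>
        divergence G f' = divergence G f \<and> acyclic (arcs_ends (support_network G f'))"
proof (induction "card {i \<in> arcs G. f i \<noteq> 0}" arbitrary: f rule: less_induct)
  case less
  show ?case
  proof (cases "acyclic (arcs_ends (support_network G f))")
    case True
    then show ?thesis by (intro exI[of _ f] conjI refl ballI) simp_all
  next
    case False
    then obtain g where g: "\<forall>i\<in>arcs G. min 0 (f i) \<le> g i \<and> g i \<le> max 0 (f i)"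
      "divergence G g = divergence G f" "{i \<in> arcs G. g i \<noteq> 0} \<subset> {i \<in> arcs G. f i \<noteq> 0}"
      by (elim cancel_one_cycle[THEN exE] conjE)
    have "card {i \<in> arcs G. g i \<noteq> 0} < card {i \<in> arcs G. f i \<noteq> 0}"
      using g(3) by (intro psubset_card_mono) simp_all
    then obtain f' where f': "\<forall>i\<in>arcs G. min 0 (g i) \<le> f' i \<and> f' i \<le> max 0 (g i)"
      "divergence G f' = divergence G g" "acyclic (arcs_ends (support_network G f'))"
      by (elim less.hyps[THEN exE] conjE)
    have "min 0 (f i) \<le> f' i \<and> f' i \<le> max 0 (f i)" if "i \<in> arcs G" for i
      using bspec[OF f'(1) that] bspec[OF g(1) that] by linarith
    moreover have "divergence G f' = divergence G f" by (rule trans[OF f'(2) g(2)])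
    ultimately show ?thesis using f'(3) by (intro exI[of _ f'] conjI) blast+
  qed
qed

text \<open>
  The number of nodes that the flow can reach from a node drops by at least one along every link that
  carries flow, so it is a potential with the right signs. After scaling by a large \<open>K\<close>, the weights
  \<open>f i\<close> divided by the potential difference lie below any given positive bounds.
\<close>

lemma acyclic_flow_realisable:
  assumes acyc: "acyclic (arcs_ends (support_network G f))"
    and wu: "\<And>i. i \<in> arcs G \<Longrightarrow> 0 < wu i"
  shows "\<exists>w. (\<forall>i\<in>arcs G. 0 \<le> w i \<and> w i \<le> wu i) \<and> is_dc_flow G w (divergence G f) f"
proof -
  let ?H = "support_network G f"
  interpret H: fin_digraph ?H by (rule fin_digraph_support_network)
  define R where "R = arcs_ends ?H"
  define rank :: "'a \<Rightarrow> real" where "rank v = card (R\<^sup>+ `` {v})" for v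
  have "finite R" unfolding R_def by (simp add: arcs_ends_def)
  have finR: "finite (R\<^sup>+ `` {v})" for v
    using \<open>finite R\<close> by (simp add: finite_Image)
  have rank: "rank b + 1 \<le> rank a" if "(a, b) \<in> R" for a b
  proof -
    have "b \<notin> R\<^sup>+ `` {b}" using acyc by (auto simp: R_def acyclic_def)
    moreover have "insert b (R\<^sup>+ `` {b}) \<subseteq> R\<^sup>+ `` {a}"
      using that by (auto intro: trancl_into_trancl2)
    ultimately have "Suc (card (R\<^sup>+ `` {b})) \<le> card (R\<^sup>+ `` {a})"
      using card_mono[OF finR, of "insert b (R\<^sup>+ `` {b})" a] finR[of b] by simp
    then show ?thesis by (simp add: rank_def)
  qed
  have fwd: "(tail G i, head G i) \<in> R" if "i \<in> arcs G" "0 < f i" for i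
    using H.in_arcs_imp_in_arcs_ends[of "Inl i"] that
    by (simp add: R_def support_network_def flow_network_def)
  have bwd: "(head G i, tail G i) \<in> R" if "i \<in> arcs G" "f i < 0" for i
    using H.in_arcs_imp_in_arcs_ends[of "Inr i"] that
    by (simp add: R_def support_network_def flow_network_def)
  define K where "K = 1 + (\<Sum>i\<in>arcs G. \<bar>f i\<bar> / wu i)"
  have "0 \<le> (\<Sum>i\<in>arcs G. \<bar>f i\<bar> / wu i)"
    using wu by (intro sum_nonneg) (simp add: less_imp_le)
  then have "0 < K" by (simp add: K_def)
  have K: "\<bar>f i\<bar> \<le> K * wu i" if "i \<in> arcs G" for i
  proof -
    have "\<bar>f i\<bar> / wu i \<le> (\<Sum>i\<in>arcs G. \<bar>f i\<bar> / wu i)"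
      using wu that by (intro member_le_sum) (auto simp: less_imp_le)
    then have "\<bar>f i\<bar> / wu i \<le> K" by (simp add: K_def)
    then show ?thesis using wu[OF that] by (simp add: field_simps)
  qed
  define D where "D i = K * rank (tail G i) - K * rank (head G i)" for i
  \<comment> \<open>If both ends have the same rank, the link carries no flow, and the quotient by zero is the weight 0,
    which satisfies the bounds.\<close>
  define w where "w i = f i / D i" for i
  have w: "0 \<le> w i \<and> w i \<le> wu i \<and> f i = w i * D i" if i: "i \<in> arcs G" for i
  proof -
    consider "0 < f i" | "f i < 0" | "f i = 0" by linarith
    then show ?thesis
    proof cases
      case 1
      then have "rank (head G i) + 1 \<le> rank (tail G i)" using rank fwd i by blast
      then have "K * (rank (head G i) + 1) \<le> K * rank (tail G i)"
        using \<open>0 < K\<close> by (intro mult_left_mono) auto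
      then have "K \<le> D i" by (simp add: D_def algebra_simps)
      then have "f i \<le> wu i * D i"
        using K[OF i] 1 wu[OF i] mult_left_mono[of K "D i" "wu i"] mult.commute[of K "wu i"]
        by linarith
      then show ?thesis
        using 1 \<open>0 < K\<close> \<open>K \<le> D i\<close> by (simp add: w_def field_simps)
    next
      case 2
      then have "rank (tail G i) + 1 \<le> rank (head G i)" using rank bwd i by blast
      then have "K * (rank (tail G i) + 1) \<le> K * rank (head G i)"
        using \<open>0 < K\<close> by (intro mult_left_mono) auto
      then have "K \<le> - D i" by (simp add: D_def algebra_simps)
      then have "- f i \<le> wu i * - D i"
        using K[OF i] 2 wu[OF i] mult_left_mono[of K "- D i" "wu i"] mult.commute[of K "wu i"]
        by linarith
      then show ?thesis
        using 2 \<open>0 < K\<close> \<open>K \<le> - D i\<close> by (simp add: w_def field_simps)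
    next
      case 3
      then show ?thesis using wu[OF i] by (simp add: w_def)
    qed
  qed
  have "is_dc_flow G w (divergence G f) f"
    unfolding is_dc_flow_def using w
    by (auto simp: D_def potential_difference intro!: exI[of _ "\<lambda>v. K * rank v"])
  then show ?thesis using w by blast
qed

section \<open>Trees\<close>

text \<open>
  \<open>U\<close> is the complement of the set of nodes that can be reached, in either direction of the links, from
  the head of \<open>a\<close> without using \<open>a\<close>. If this set contained the tail of \<open>a\<close>, a path to it would close
  with \<open>a\<close> to an undirected cycle.
\<close>

lemma fundamental_cut:
  assumes "\<nexists>p. undirected_cycle G p" and a: "a \<in> arcs G"
  shows "\<exists>U. U \<subseteq> verts G \<and> tail G a \<in> U \<and> head G a \<notin> U \<and>
             (\<forall>i\<in>arcs G - {a}. tail G i \<in> U \<longleftrightarrow> head G i \<in> U)"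
proof -
  let ?N = "flow_network G"
  define H where "H = ?N\<lparr>arcs := (arcs G - {a}) <+> (arcs G - {a})\<rparr>"
  have sel: "verts H = verts G" "arcs H = (arcs G - {a}) <+> (arcs G - {a})"
    "tail H = case_sum (tail G) (head G)" "head H = case_sum (head G) (tail G)"
    "tail ?N = tail H" "head ?N = head H" "verts ?N = verts G" "arcs ?N = arcs G <+> arcs G"
    by (simp_all add: H_def flow_network_def)
  interpret N: fin_digraph ?N by (rule fin_digraph_flow_network)
  interpret H: wf_digraph H
    by unfold_locales (auto simp: sel)
  define R where "R = {v. head G a \<rightarrow>\<^sup>*\<^bsub>H\<^esub> v}"
  have "R \<subseteq> verts G" using H.reachable_in_verts sel by (auto simp: R_def)
  moreover have "head G a \<in> R" using a by (auto simp: R_def sel)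
  moreover have "tail G a \<notin> R"
  proof
    assume "tail G a \<in> R"
    then obtain p where p: "H.apath (head G a) p (tail G a)"
      unfolding R_def using H.reachable_apath by auto
    \<comment> \<open>Both copies of a link have the same two ends, so using both would repeat a node of the path.\<close>
    have link_distinct: "distinct (map (case_sum id id) q)" if "H.apath x q y" for x q y
      using that
    proof (induction q arbitrary: x)
      case (Cons e q)
      then have q: "H.apath (head H e) q y" and e: "tail H e \<notin> set (H.awalk_verts (head H e) q)"
        unfolding H.apath_Cons_iff by blast+
      have ends: "tail H e' \<in> set (H.awalk_verts (head H e) q)"
        "head H e' \<in> set (H.awalk_verts (head H e) q)" if "e' \<in> set q" for e'
        using that q by (auto simp: H.apath_def H.set_awalk_verts)
      have "case_sum id id e \<notin> case_sum id id ` set q"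
      proof
        assume "case_sum id id e \<in> case_sum id id ` set q"
        then obtain e' where "e' \<in> set q" "case_sum id id e' = (case_sum id id e :: 'b)" by auto
        then have "tail H e = tail H e' \<or> tail H e = head H e'"
          by (auto simp: sel split: sum.splits)
        then show False using ends[OF \<open>e' \<in> set q\<close>] e by auto
      qed
      then show ?case using Cons.IH[OF q] by simp
    qed simp
    have walk: "N.awalk (head G a) p (tail G a)" "N.awalk_verts = H.awalk_verts"
    proof -
      show verts: "N.awalk_verts = H.awalk_verts"
      proof (intro ext)
        show "N.awalk_verts u q = H.awalk_verts u q" for u q
          by (induction q arbitrary: u) (auto simp: sel N.awalk_verts.simps H.awalk_verts.simps)
      qed
      have "N.cas u q w = H.cas u q w" for u q w
        by (induction q arbitrary: u) (auto simp: sel N.cas.simps H.cas.simps)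
      then show "N.awalk (head G a) p (tail G a)"
        using p by (auto simp: H.apath_def H.awalk_def N.awalk_def sel)
    qed
    have "N.awalk (tail G a) (Inl a # p) (tail G a)"
      using walk a by (auto simp: N.awalk_Cons_iff sel)
    moreover have "distinct (tl (N.awalk_verts (tail G a) (Inl a # p)))"
      using p walk by (simp add: H.apath_def sel)
    ultimately have "N.cycle (Inl a # p)" by (auto simp: N.cycle_def)
    moreover have "a \<notin> case_sum id id ` set p"
      using p by (auto simp: H.apath_def H.awalk_def sel)
    ultimately have "undirected_cycle G (Inl a # p)"
      using link_distinct[OF p] by (simp add: undirected_cycle_def)
    then show False using assms by blast
  qed
  moreover have "tail G i \<in> R \<longleftrightarrow> head G i \<in> R" if "i \<in> arcs G - {a}" for i
  proof -
    have "H.arc (Inl i) (tail G i, head G i)" "H.arc (Inr i) (head G i, tail G i)"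
      using that by (auto simp: H.arc_def sel)
    then show ?thesis unfolding R_def using H.reachable_arc_trans by blast
  qed
  ultimately show ?thesis
    using a by (intro exI[of _ "verts G - R"]) auto
qed

text \<open>
  The indicator of the fundamental cut of \<open>a\<close> has potential difference 1 across \<open>a\<close> and 0 across every
  other link. Combine these indicators linearly.
\<close>

lemma forest_potential_exists:
  assumes "\<nexists>p. undirected_cycle G p"
  shows "\<exists>\<phi>. \<forall>i\<in>arcs G. \<phi> (tail G i) - \<phi> (head G i) = (x i :: real)"
proof -
  obtain S where S: "\<And>a. a \<in> arcs G \<Longrightarrow> tail G a \<in> S a \<and> head G a \<notin> S a \<and>
      (\<forall>i\<in>arcs G - {a}. tail G i \<in> S a \<longleftrightarrow> head G i \<in> S a)"
    using fundamental_cut[OF assms] by metis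
  define \<phi> where "\<phi> v = (\<Sum>a\<in>arcs G. x a * of_bool (v \<in> S a))" for v
  have "\<phi> (tail G i) - \<phi> (head G i) = x i" if "i \<in> arcs G" for i
  proof -
    have "\<phi> (tail G i) - \<phi> (head G i) = (\<Sum>a\<in>arcs G. if a = i then x i else 0)"
      unfolding \<phi>_def sum_subtractf[symmetric]
    proof (intro sum.cong)
      fix a assume "a \<in> arcs G"
      then show "x a * of_bool (tail G i \<in> S a) - x a * of_bool (head G i \<in> S a)
          = (if a = i then x i else 0)"
        using S[of a] that by (cases "a = i") auto
    qed simp
    also have "\<dots> = x i" using that by simp
    finally show ?thesis .
  qed
  then show ?thesis by blast
qed

lemma forest_flow_realisable:
  assumes "\<nexists>p. undirected_cycle G p" and "\<And>i. i \<in> arcs G \<Longrightarrow> 0 < w i"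
  shows "is_dc_flow G w (divergence G f) f"
proof -
  obtain \<phi> where "\<And>i. i \<in> arcs G \<Longrightarrow> \<phi> (tail G i) - \<phi> (head G i) = f i / w i"
    using forest_potential_exists[OF assms(1), of "\<lambda>i. f i / w i"] by blast
  then show ?thesis
    unfolding is_dc_flow_def using assms(2)
    by (intro conjI exI[of _ \<phi>]) (auto simp: potential_difference less_imp_neq[symmetric])
qed

end

section \<open>The margin of robustness\<close>

lemma is_dc_flow_cong:
  assumes "is_dc_flow G w p f" and "\<And>v. v \<in> verts G \<Longrightarrow> p v = q v"
  shows "is_dc_flow G w q f"
  using assms by (simp add: is_dc_flow_def)

text \<open>
  The flow \<open>f0\<close> serves as a reference point: the room that it leaves within the bounds is measured by the
  cuts, and its divergence is the demand to which a perturbation is added.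
\<close>

locale initial_flow = loopfree_multigraph +
  fixes cl cu f0 :: "'b \<Rightarrow> real" and p0 :: "'a \<Rightarrow> real"
  assumes f0_bounds: "\<forall>i\<in>arcs G. cl i \<le> f0 i \<and> f0 i \<le> cu i"
    and f0_divergence: "\<forall>v\<in>verts G. divergence G f0 v = p0 v"
begin

abbreviation residual_cut :: "'a set \<Rightarrow> real" where
  "residual_cut \<equiv> cut_bound (arcs G) (tail G) (head G) (\<lambda>i. cu i - f0 i) (\<lambda>i. f0 i - cl i)"

abbreviation min_cut :: ereal where
  "min_cut \<equiv> min_cut_capacity (flow_network G) (flow_capacity cl cu f0)"

lemma min_cut_eq: "min_cut = (INF U\<in>{U. {} \<subset> U \<and> U \<subset> verts G}. ereal (residual_cut U))"
  unfolding min_cut_capacity_def by (simp add: cut_capacity_flow_network) (simp add: flow_network_def)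

lemma residual_cut_nonneg: "0 \<le> residual_cut U"
  unfolding cut_bound_def using f0_bounds by (intro sum_nonneg) auto

lemma min_cut_attained:
  assumes "u \<in> verts G" and "v \<in> verts G" and "u \<noteq> v"
  obtains M where "{} \<subset> M" and "M \<subset> verts G" and "min_cut = ereal (residual_cut M)"
    and "\<forall>U. {} \<subset> U \<and> U \<subset> verts G \<longrightarrow> residual_cut M \<le> residual_cut U"
proof -
  let ?S = "{U. {} \<subset> U \<and> U \<subset> verts G}"
  have fin: "finite ?S"
    by (rule finite_subset[of _ "Pow (verts G)"]) auto
  have "{u} \<in> ?S" using assms by auto
  then have ne: "?S \<noteq> {}" by blast
  define M where "M = arg_min_on residual_cut ?S"
  have M: "M \<in> ?S" unfolding M_def using fin ne by (rule arg_min_if_finite)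
  have least: "residual_cut M \<le> residual_cut U" if "U \<in> ?S" for U
    unfolding M_def using fin ne that by (rule arg_min_least)
  have "min_cut = ereal (residual_cut M)"
    unfolding min_cut_eq
  proof (rule antisym)
    show "(INF U\<in>?S. ereal (residual_cut U)) \<le> ereal (residual_cut M)" using M by (rule INF_lower)
    show "ereal (residual_cut M) \<le> (INF U\<in>?S. ereal (residual_cut U))" using least by (intro INF_greatest) simp
  qed
  then show thesis using that M least by blast
qed

text \<open>
  A single direction suffices for an upper bound on the infimum: move half a unit across the cut. The net
  flow out of \<open>U\<close> then increases by \<open>\<mu> / 2\<close>, and the cut leaves room for its capacity only.
\<close>

lemma margin_le_cut:
  assumes U: "{} \<subset> U" "U \<subset> verts G"
  shows "margin_of_robustness G wl wu cl cu p0 \<le> 2 * ereal (residual_cut U)"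
proof -
  obtain u v where u: "u \<in> U" "u \<in> verts G" and v: "v \<in> verts G" "v \<notin> U" using U by blast
  define \<delta> :: "'a \<Rightarrow> real" where "\<delta> x = (of_bool (x = u) - of_bool (x = v)) / 2" for x
  have single: "(\<Sum>x\<in>A. of_bool (x = y)) = (of_bool (y \<in> A) :: real)" if "A \<subseteq> verts G" for A y
    using finite_subset[OF that] by (simp add: of_bool_def)
  have "l1_norm_on (verts G) \<delta> = (\<Sum>x\<in>verts G. of_bool (x = u) + of_bool (x = v)) / 2"
    unfolding l1_norm_on_def sum_divide_distrib
    using u v by (intro sum.cong) (auto simp: \<delta>_def)
  then have "l1_norm_on (verts G) \<delta> = 1" using u v single by (simp add: sum.distrib)
  moreover have "balanced G \<delta>"
    using u v single by (simp add: balanced_def \<delta>_def sum_divide_distrib[symmetric] sum_subtractf)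
  ultimately have "margin_of_robustness G wl wu cl cu p0 \<le> margin_dir G wl wu cl cu p0 \<delta>"
    unfolding margin_of_robustness_def by (intro INF_lower) simp
  also have "\<dots> \<le> ereal (2 * residual_cut U)"
    unfolding margin_dir_def
  proof (intro SUP_least, clarify)
    fix \<mu> w f
    assume flow: "is_dc_flow G w (\<lambda>v. p0 v + \<mu> * \<delta> v) f"
      and f: "\<forall>i\<in>arcs G. cl i \<le> f i \<and> f i \<le> cu i"
    let ?x = "\<lambda>i. of_bool (tail G i \<in> U) - of_bool (head G i \<in> U) :: real"
    have "\<mu> / 2 = (\<Sum>x\<in>U. \<mu> * \<delta> x)"
      using u v U single[of U] unfolding sum_distrib_left[symmetric]
      by (simp add: \<delta>_def sum_divide_distrib[symmetric] sum_subtractf)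
    also have "\<dots> = (\<Sum>x\<in>U. divergence G f x) - (\<Sum>x\<in>U. divergence G f0 x)"
    proof (subst sum_subtractf[symmetric], intro sum.cong refl)
      fix x assume "x \<in> U"
      then have "x \<in> verts G" using U by blast
      then show "\<mu> * \<delta> x = divergence G f x - divergence G f0 x"
        using flow f0_divergence by (simp add: is_dc_flow_def)
    qed
    also have "\<dots> = (\<Sum>i\<in>arcs G. ?x i * (f i - f0 i))"
      using U by (simp add: sum_divergence sum_subtractf right_diff_distrib)
    also have "\<dots> \<le> residual_cut U"
      unfolding cut_bound_def using f by (intro sum_mono) auto
    finally show "ereal \<mu> \<le> ereal (2 * residual_cut U)" by simp
  qed
  finally show ?thesis by simp
qed

text \<open>
  With at least two nodes, the minimum over the cuts is attained; with one node there is no cut, and the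
  bound is infinite.
\<close>

lemma margin_le_min_cut: "margin_of_robustness G wl wu cl cu p0 \<le> 2 * min_cut"
proof (cases "\<exists>u\<in>verts G. \<exists>v\<in>verts G. u \<noteq> v")
  case True
  then obtain U where U: "{} \<subset> U" "U \<subset> verts G" "min_cut = ereal (residual_cut U)"
    using min_cut_attained by metis
  show ?thesis unfolding U(3) using U(1,2) by (rule margin_le_cut)
next
  case False
  have "\<not> ({} \<subset> U \<and> U \<subset> verts G)" for U
  proof
    assume "{} \<subset> U \<and> U \<subset> verts G"
    then obtain u v where "u \<in> U" "u \<in> verts G" "v \<in> verts G" "v \<notin> U" by blast
    then show False using False by metis
  qed
  then have none: "{U. {} \<subset> U \<and> U \<subset> verts G} = {}" by simp
  show ?thesis unfolding min_cut_eq none by (simp add: top_ereal_def)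
qed

text \<open>
  The demand \<open>2 m \<delta>\<close> sums to at most \<open>m\<close> over any set, and to zero over all nodes, so
  Gale's theorem applies to the room that \<open>f0\<close> leaves within the bounds.
\<close>

lemma flow_up_to_cut_bound:
  assumes "0 \<le> m" and m_le: "\<And>U. {} \<subset> U \<Longrightarrow> U \<subset> verts G \<Longrightarrow> m \<le> residual_cut U"
    and \<delta>: "l1_norm_on (verts G) \<delta> = 1" "balanced G \<delta>"
  shows "\<exists>f. (\<forall>i\<in>arcs G. cl i \<le> f i \<and> f i \<le> cu i) \<and>
             (\<forall>v\<in>verts G. divergence G f v = p0 v + 2 * m * \<delta> v)"
proof -
  have \<delta>_sum: "sum \<delta> (verts G) = 0" using \<delta>(2) by (simp add: balanced_def)
  define d where "d v = 2 * m * \<delta> v" for v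
  have sum_d: "sum d U = m * (2 * sum \<delta> U)" for U
    unfolding d_def sum_distrib_left[symmetric] by simp
  have "\<exists>g. (\<forall>i\<in>arcs G. - (f0 i - cl i) \<le> g i \<and> g i \<le> cu i - f0 i) \<and>
      (\<forall>v\<in>verts G. (\<Sum>i\<in>arcs G. (of_bool (v = tail G i) - of_bool (v = head G i)) * g i) = d v)"
  proof (rule gale_supply_demand)
    show "sum d (verts G) = 0" by (simp add: sum_d \<delta>_sum)
    fix U assume sub: "U \<subseteq> verts G"
    show "sum d U \<le> residual_cut U"
    proof (cases "U = {} \<or> U = verts G")
      case True
      then have "sum d U = 0" using \<delta>_sum sum_d[of U] by auto
      then show ?thesis using residual_cut_nonneg[of U] by simp
    next
      case False
      then have "m \<le> residual_cut U" using sub by (intro m_le) auto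
      moreover have "2 * sum \<delta> U \<le> 1"
        using twice_sum_le_l1_norm[OF finite_verts sub \<delta>_sum] \<delta>(1) by simp
      then have "sum d U \<le> m"
        unfolding sum_d using \<open>0 \<le> m\<close> mult_left_mono[of "2 * sum \<delta> U" 1 m] by simp
      ultimately show ?thesis by simp
    qed
  qed (use f0_bounds in auto)
  then obtain g where g: "\<forall>i\<in>arcs G. - (f0 i - cl i) \<le> g i \<and> g i \<le> cu i - f0 i"
    "\<forall>v\<in>verts G. (\<Sum>i\<in>arcs G. (of_bool (v = tail G i) - of_bool (v = head G i)) * g i) = d v"
    by blast
  have "divergence G (\<lambda>i. f0 i + g i) v = p0 v + 2 * m * \<delta> v" if v: "v \<in> verts G" for v
  proof -
    have "divergence G g v = d v"
      unfolding bspec[OF g(2) v, symmetric] by (intro sum.cong) (simp_all add: incidence_eq)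
    moreover have "divergence G (\<lambda>i. f0 i + g i) v = divergence G f0 v + divergence G g v"
      by (simp only: distrib_left sum.distrib)
    ultimately show ?thesis
      unfolding d_def using bspec[OF f0_divergence v] by simp
  qed
  moreover have "cl i \<le> f0 i + g i \<and> f0 i + g i \<le> cu i" if "i \<in> arcs G" for i
    using bspec[OF g(1) that] by linarith
  ultimately show ?thesis by (intro exI[of _ "\<lambda>i. f0 i + g i"] conjI ballI) simp_all
qed

text \<open>
  At \<open>\<mu>\<close> equal to twice the minimum cut there is a flow within the bounds in every direction \<open>\<delta>\<close>. It need
  not come from a potential; the premise provides a flow of the same divergence that does, for
  admissible weights.
\<close>

lemma min_cut_le_margin:
  assumes realisable: "\<And>f. \<forall>i\<in>arcs G. cl i \<le> f i \<and> f i \<le> cu i \<Longrightarrow>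
      \<exists>w f'. (\<forall>i\<in>arcs G. wl i \<le> w i \<and> w i \<le> wu i) \<and> is_dc_flow G w (divergence G f) f' \<and>
             (\<forall>i\<in>arcs G. cl i \<le> f' i \<and> f' i \<le> cu i)"
  shows "2 * min_cut \<le> margin_of_robustness G wl wu cl cu p0"
  unfolding margin_of_robustness_def
proof (intro INF_greatest)
  fix \<delta> assume "\<delta> \<in> {\<delta>. l1_norm_on (verts G) \<delta> = 1 \<and> balanced G \<delta>}"
  then have \<delta>: "l1_norm_on (verts G) \<delta> = 1" "balanced G \<delta>" by simp_all
  have "\<exists>u\<in>verts G. \<exists>v\<in>verts G. u \<noteq> v"
  proof (rule ccontr)
    assume single: "\<not> ?thesis"
    have "\<delta> v = 0" if "v \<in> verts G" for v
    proof -
      have "verts G = {v}" using single that by blast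
      then show ?thesis using \<delta>(2) unfolding balanced_def by simp
    qed
    then show False using \<delta>(1) by (simp add: l1_norm_on_def)
  qed
  then obtain u v where uv: "u \<in> verts G" "v \<in> verts G" "u \<noteq> v" by blast
  obtain M where "{} \<subset> M" and "M \<subset> verts G" and M: "min_cut = ereal (residual_cut M)"
      "\<forall>U. {} \<subset> U \<and> U \<subset> verts G \<longrightarrow> residual_cut M \<le> residual_cut U"
    by (rule min_cut_attained[OF uv])
  have "\<exists>f. (\<forall>i\<in>arcs G. cl i \<le> f i \<and> f i \<le> cu i) \<and>
            (\<forall>v\<in>verts G. divergence G f v = p0 v + 2 * residual_cut M * \<delta> v)"
    by (rule flow_up_to_cut_bound[OF residual_cut_nonneg _ \<delta>]) (simp add: M(2))
  then obtain f where f: "\<forall>i\<in>arcs G. cl i \<le> f i \<and> f i \<le> cu i"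
    and div: "\<forall>v\<in>verts G. divergence G f v = p0 v + 2 * residual_cut M * \<delta> v"
    by (elim exE conjE)
  obtain w f' where w: "\<forall>i\<in>arcs G. wl i \<le> w i \<and> w i \<le> wu i"
    and flow: "is_dc_flow G w (divergence G f) f'"
    and f': "\<forall>i\<in>arcs G. cl i \<le> f' i \<and> f' i \<le> cu i"
    using realisable[OF f] by (elim exE conjE)
  have "is_dc_flow G w (\<lambda>v. p0 v + 2 * residual_cut M * \<delta> v) f'"
    by (rule is_dc_flow_cong[OF flow]) (rule bspec[OF div])
  moreover have "0 \<le> 2 * residual_cut M" using residual_cut_nonneg[of M] by simp
  ultimately have "ereal (2 * residual_cut M) \<le> margin_dir G wl wu cl cu p0 \<delta>"
    unfolding margin_dir_def using w f' by (intro SUP_upper CollectI conjI exI)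
  then show "2 * min_cut \<le> margin_dir G wl wu cl cu p0 \<delta>"
    by (simp add: M(1))
qed

text \<open>
  The fundamental cut of a link and its complement have the residual capacities of this link in its two
  directions as their capacities, so the minimum over cuts is at most the one over links. Conversely,
  every cut is crossed by a link, whose residual capacity is a lower bound for the cut.
\<close>

lemma tree_min_cut:
  assumes "undirected_tree G"
  shows "min_cut = (INF i\<in>arcs G. ereal (min (f0 i - cl i) (cu i - f0 i)))" (is "_ = ?I")
  unfolding min_cut_eq
proof (rule antisym)
  show "(INF U\<in>{U. {} \<subset> U \<and> U \<subset> verts G}. ereal (residual_cut U)) \<le> ?I"
  proof (intro INF_greatest)
    fix a assume a: "a \<in> arcs G"
    then obtain U where U: "U \<subseteq> verts G" "tail G a \<in> U" "head G a \<notin> U"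
      "\<And>i. i \<in> arcs G - {a} \<Longrightarrow> tail G i \<in> U \<longleftrightarrow> head G i \<in> U"
      using fundamental_cut[OF _ a] assms unfolding undirected_tree_def by blast
    have ends: "tail G a \<in> verts G" "head G a \<in> verts G" using a by auto
    have "residual_cut U = (\<Sum>i\<in>arcs G. if i = a then cu a - f0 a else 0)"
      unfolding cut_bound_def using U by (intro sum.cong) auto
    then have "residual_cut U = cu a - f0 a" using a by simp
    have "residual_cut (verts G - U) = (\<Sum>i\<in>arcs G. if i = a then f0 a - cl a else 0)"
      unfolding cut_bound_def using U by (intro sum.cong) auto
    then have "residual_cut (verts G - U) = f0 a - cl a" using a by simp
    have cut: "U \<in> {U. {} \<subset> U \<and> U \<subset> verts G}" "verts G - U \<in> {U. {} \<subset> U \<and> U \<subset> verts G}"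
      using U ends by auto
    show "(INF U\<in>{U. {} \<subset> U \<and> U \<subset> verts G}. ereal (residual_cut U))
        \<le> ereal (min (f0 a - cl a) (cu a - f0 a))"
      using INF_lower[OF cut(1), of "\<lambda>U. ereal (residual_cut U)"]
        INF_lower[OF cut(2), of "\<lambda>U. ereal (residual_cut U)"]
        \<open>residual_cut U = cu a - f0 a\<close> \<open>residual_cut (verts G - U) = f0 a - cl a\<close>
      by (simp add: min_def)
  qed
  show "?I \<le> (INF U\<in>{U. {} \<subset> U \<and> U \<subset> verts G}. ereal (residual_cut U))"
  proof (intro INF_greatest)
    fix U assume "U \<in> {U. {} \<subset> U \<and> U \<subset> verts G}"
    then have "{} \<subset> U" "U \<subset> verts G" by blast+
    then obtain a where a: "a \<in> arcs G" "(tail G a \<in> U) \<noteq> (head G a \<in> U)"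
      using connected_cut_nonempty assms unfolding undirected_tree_def by blast
    have "min (f0 a - cl a) (cu a - f0 a) \<le>
        (if tail G a \<in> U \<and> head G a \<notin> U then cu a - f0 a
         else if head G a \<in> U \<and> tail G a \<notin> U then f0 a - cl a else 0)"
      using a by auto
    also have "\<dots> \<le> residual_cut U"
      unfolding cut_bound_def using f0_bounds a(1)
      by (intro member_le_sum[where f = "\<lambda>i. if tail G i \<in> U \<and> head G i \<notin> U then cu i - f0 i
            else if head G i \<in> U \<and> tail G i \<notin> U then f0 i - cl i else 0"]) auto
    finally have "ereal (min (f0 a - cl a) (cu a - f0 a)) \<le> ereal (residual_cut U)"
      by (simp only: ereal_less_eq)
    then show "?I \<le> ereal (residual_cut U)" using a(1) by (rule INF_lower2[rotated])
  qed
qed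

end

theorem proposition2:
  fixes G :: "('a, 'b) pre_digraph"
    and wl wu cl cu w0 f0 :: "'b \<Rightarrow> real"
    and p0 :: "'a \<Rightarrow> real"
  assumes "fin_digraph G" and "loopfree_digraph G"
    and "Digraph_Component.connected G"
    and "\<forall>i\<in>arcs G. 0 \<le> wl i" and "\<forall>i\<in>arcs G. 0 < wu i"
    and "\<forall>i\<in>arcs G. cl i < 0" and "\<forall>i\<in>arcs G. 0 < cu i"
    and "balanced G p0"
    and "\<forall>i\<in>arcs G. wl i \<le> w0 i \<and> w0 i \<le> wu i" and "\<forall>i\<in>arcs G. 0 < w0 i"
    and "is_dc_flow G w0 p0 f0"
    and "\<forall>i\<in>arcs G. cl i \<le> f0 i \<and> f0 i \<le> cu i"
  shows "margin_of_robustness G wl wu cl cu p0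
           \<le> 2 * min_cut_capacity (flow_network G) (flow_capacity cl cu f0) \<and>
         (undirected_tree G \<or> (\<forall>i\<in>arcs G. wl i = 0) \<longrightarrow>
           margin_of_robustness G wl wu cl cu p0
             = 2 * min_cut_capacity (flow_network G) (flow_capacity cl cu f0)) \<and>
         (undirected_tree G \<longrightarrow>
           margin_of_robustness G wl wu cl cu p0
             = 2 * (INF i\<in>arcs G. ereal (min (f0 i - cl i) (cu i - f0 i))))"
proof -
  interpret fin_digraph G by fact
  interpret loopfree_digraph G by fact
  interpret loopfree_multigraph G ..
  interpret initial_flow G cl cu f0 p0
    using assms(11,12) by unfold_locales (simp_all add: is_dc_flow_def)
  have tree: "2 * min_cut \<le> margin_of_robustness G wl wu cl cu p0" if "undirected_tree G"
  proof (rule min_cut_le_margin)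
    fix f assume f: "\<forall>i\<in>arcs G. cl i \<le> f i \<and> f i \<le> cu i"
    have "is_dc_flow G w0 (divergence G f) f"
      using that assms(10) by (intro forest_flow_realisable) (auto simp: undirected_tree_def)
    then show "\<exists>w f'. (\<forall>i\<in>arcs G. wl i \<le> w i \<and> w i \<le> wu i) \<and>
        is_dc_flow G w (divergence G f) f' \<and> (\<forall>i\<in>arcs G. cl i \<le> f' i \<and> f' i \<le> cu i)"
      using f assms(9) by blast
  qed
  have zero: "2 * min_cut \<le> margin_of_robustness G wl wu cl cu p0" if wl: "\<forall>i\<in>arcs G. wl i = 0"
  proof (rule min_cut_le_margin)
    fix f assume f: "\<forall>i\<in>arcs G. cl i \<le> f i \<and> f i \<le> cu i"
    obtain f' where f': "\<forall>i\<in>arcs G. min 0 (f i) \<le> f' i \<and> f' i \<le> max 0 (f i)"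
      and div: "divergence G f' = divergence G f"
      and acyc: "acyclic (arcs_ends (support_network G f'))"
      using cancel_cycles[of f] by (elim exE conjE)
    obtain w where w: "\<forall>i\<in>arcs G. 0 \<le> w i \<and> w i \<le> wu i"
      and flow: "is_dc_flow G w (divergence G f') f'"
      using acyclic_flow_realisable[OF acyc, of wu] assms(5) by blast
    have "cl i \<le> f' i \<and> f' i \<le> cu i" if "i \<in> arcs G" for i
      using bspec[OF f' that] bspec[OF f that] bspec[OF assms(6) that] bspec[OF assms(7) that]
      by linarith
    moreover have "\<forall>i\<in>arcs G. wl i \<le> w i \<and> w i \<le> wu i" using w wl by simp
    ultimately show "\<exists>w f'. (\<forall>i\<in>arcs G. wl i \<le> w i \<and> w i \<le> wu i) \<and>
        is_dc_flow G w (divergence G f) f' \<and> (\<forall>i\<in>arcs G. cl i \<le> f' i \<and> f' i \<le> cu i)"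
      using flow[unfolded div] by blast
  qed
  have ge: "2 * min_cut \<le> margin_of_robustness G wl wu cl cu p0"
    if "undirected_tree G \<or> (\<forall>i\<in>arcs G. wl i = 0)"
    using that tree zero by blast
  have eq: "margin_of_robustness G wl wu cl cu p0 = 2 * min_cut"
    if "undirected_tree G \<or> (\<forall>i\<in>arcs G. wl i = 0)"
    using margin_le_min_cut ge[OF that] by (rule antisym)
  show ?thesis
  proof (intro conjI impI)
    show "margin_of_robustness G wl wu cl cu p0 \<le> 2 * min_cut"
      by (rule margin_le_min_cut)
    show "margin_of_robustness G wl wu cl cu p0 = 2 * min_cut"
      if "undirected_tree G \<or> (\<forall>i\<in>arcs G. wl i = 0)"
      using that by (rule eq)
    assume G_tree: "undirected_tree G"
    show "margin_of_robustness G wl wu cl cu p0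
        = 2 * (INF i\<in>arcs G. ereal (min (f0 i - cl i) (cu i - f0 i)))"
      using eq G_tree unfolding tree_min_cut[OF G_tree] by blast
  qed
qed

end
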